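(* Let a system with coordinates $q=(q_1,\dots,q_n)$, $n=m+k$, be subject to stationary linear kinematic constraints $$\dot q_{m+\nu}=\alpha_\nu=\sum_{j=1}^m\alpha_{\nu,j}(q_1,\dots,q_n)\,\dot q_j,\qquad\nu=1,\dots,k,$$ and to active forces $\mathcal F=\nabla_{\bf X}\mathcal U({\bf X},t)$ coming from a potential $\mathcal U$, so that $\mathcal F^{(q_i)}=\partial U/\partial q_i$ for $i=1,\dots,n$, where $U(q_1,\dots,q_n,t)=\mathcal U({\bf X}(q_1,\dots,q_n,t),t)$. Let $\mathcal L^*=T^*+U$ and assume $\frac{\partial\mathcal L^*}{\partial t}=0$. Then the quantity $$I(q_1,\dots,q_n,\dot q_1,\dots,\dot q_m)=\sum_{i=1}^m\dot q_i\frac{\partial\mathcal L^*}{\partial\dot q_i}-\mathcal L^*$$ is conserved along every solution of the equations of motion $$\frac{d}{dt}\frac{\partial T^*}{\partial \dot q_i}-\frac{\partial T^*}{\partial q_i}-\sum_{\nu=1}^k\frac{\partial T^*}{\partial q_{m+\nu}}\frac{\partial\alpha_\nu}{\partial\dot q_i}-\sum_{\nu=1}^k B_i^\nu\frac{\partial T}{\partial\dot q_{m+\nu}}=\mathcal F^{(q_i)}+\sum_{\nu=1}^k\frac{\partial\alpha_\nu}{\partial\dot q_i}\mathcal F^{(q_{m+\nu})},\qquad i=1,\dots,m,$$ joined with the constraint equations. Moreover, writing $T=\frac12\sum_{i,j=1}^n g_{i,j}\dot q_i\dot q_j+\sum_{i=1}^n b_i\dot q_i+c$ with $g_{i,j}$,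 $b_i$, $c$ ($i,j=1,\dots,n$) not depending on $t$ explicitly, the constant of motion is $$I=\sum_{r,s=1}^m\left(\frac12 g_{r,s}+\frac12\sum_{\nu,\mu=1}^k g_{m+\nu,m+\mu}\,\alpha_{\nu,r}\,\alpha_{\mu,s}+\sum_{\nu=1}^k g_{r,m+\nu}\,\alpha_{\nu,s}\right)\dot q_r\dot q_s-U-c.$$
   Context: All functions are assumed as smooth as needed. ${\bf X}(q_1,\dots,q_n,t)\in\mathbb R^{3N}$ gives the positions of $N$ material points $P_1,\dots,P_N$ with masses $M_1,\dots,M_N>0$, and ${\bf X}^{(\mathsf M)}=(M_1P_1,\dots,M_NP_N)$. The kinetic energy is $T(q_1,\dots,q_n,\dot q_1,\dots,\dot q_n,t)=\frac12\dot{\bf X}^{(\mathsf M)}\cdot\dot{\bf X}$, with $\dot{\bf X}=\sum_{i=1}^n\frac{\partial{\bf X}}{\partial q_i}\dot q_i+\frac{\partial{\bf X}}{\partial t}$ (and the same for ${\bf X}^{(\mathsf M)}$); thus $g_{i,j}=\frac{\partial{\bf X}^{(\mathsf M)}}{\partial q_i}\cdot\frac{\partial{\bf X}}{\partial q_j}$, $b_i=\frac{\partial{\bf X}^{(\mathsf M)}}{\partial q_i}\cdot\frac{\partial{\bf X}}{\partial t}$, $c=\frac12\frac{\partial{\bf X}^{(\mathsf M)}}{\partial t}\cdot\frac{\partial{\bf X}}{\partial t}$. For active forces $\mathcal F\in\mathbb R^{3N}$, the generalized forces are $\mathcal F^{(q_j)}=\mathcal F\cdot\frac{\partial{\bf X}}{\partial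 q_j}$, $j=1,\dots,n$. The restricted kinetic energy is $T^*(q_1,\dots,q_n,\dot q_1,\dots,\dot q_m,t)=T(q_1,\dots,q_n,\dot q_1,\dots,\dot q_m,\alpha_1,\dots,\alpha_k,t)$, and $\mathcal L^*(q_1,\dots,q_n,\dot q_1,\dots,\dot q_m,t)=T^*(q_1,\dots,q_n,\dot q_1,\dots,\dot q_m,t)+U(q_1,\dots,q_n,t)$. In $\partial T/\partial\dot q_{m+\nu}$ the derivative of the unrestricted $T$ is taken first and then $\dot q_{m+1},\dots,\dot q_n$ are replaced by $\alpha_1,\dots,\alpha_k$. Partial derivatives of $T^*,\mathcal L^*,\alpha_\nu$ are with respect to the independent arguments $(q_1,\dots,q_n,\dot q_1,\dots,\dot q_m,t)$. The coefficients in the equations of motion are $$B_i^\nu=\sum_{r=1}^m\left(\frac{\partial^2\alpha_\nu}{\partial\dot q_i\partial q_r}\dot q_r+\frac{\partial^2\alpha_\nu}{\partial\dot q_i\partial\dot q_r}\ddot q_r\right)-\frac{\partial\alpha_\nu}{\partial q_i}+\sum_{\mu=1}^k\left(\frac{\partial^2\alpha_\nu}{\partial\dot q_i\partial q_{m+\mu}}\alpha_\mu-\frac{\partial\alpha_\mu}{\partial\dot q_i}\frac{\partial\alpha_\nu}{\partial q_{m+\mu}}\right)+\frac{\partial^2\alpha_\nu}{\partial\dot q_i\partial t}.$$ The total derivative $\frac{d}{dt}$ is taken along a motion $t\mapsto q(t)$ satisfying the constraints. *)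

theory Defs
  imports "HOL-Analysis.Analysis"
begin

text \<open>
  Lagrangian coordinates are vectors of \<^typ>\<open>real^('m + 'k)\<close>: the component \<open>Inl r\<close> is the
  coordinate $q_r$ with independent velocity ($1 \le r \le m$) and \<open>Inr \<nu>\<close> is $q_{m+\nu}$
  ($1 \le \nu \le k$).  The space $R^{3N}$ of the positions of the $N$ points is \<open>(real^3)^'p\<close>.
\<close>

primrec Ck_on :: "nat \<Rightarrow> ('a::real_normed_vector \<Rightarrow> 'b::real_normed_vector) \<Rightarrow> 'a set \<Rightarrow> bool" where
  "Ck_on 0 f S \<longleftrightarrow> continuous_on S f"
| "Ck_on (Suc l) f S \<longleftrightarrow>
     (\<forall>x\<in>S. f differentiable (at x)) \<and> (\<forall>h. Ck_on l (\<lambda>x. frechet_derivative f (at x) h) S)"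

definition partial :: "(real^'a \<Rightarrow> 'b::real_normed_vector) \<Rightarrow> 'a \<Rightarrow> real^'a \<Rightarrow> 'b" where
  "partial f i x = vector_derivative (\<lambda>s. f (x + s *\<^sub>R axis i 1)) (at 0)"

type_synonym ('m, 'k, 'p) placement = "real^('m + 'k) \<Rightarrow> real \<Rightarrow> (real^3)^'p"

text \<open>Velocity constraint functions \<open>\<alpha> \<nu> q v t\<close>, where \<open>v\<close> holds the independent velocities only.\<close>

type_synonym ('m, 'k) constraints = "'k \<Rightarrow> real^('m + 'k) \<Rightarrow> real^'m \<Rightarrow> real \<Rightarrow> real"

definition mass_weighted ::
  "('p::finite \<Rightarrow> real) \<Rightarrow> ('m::finite, 'k::finite, 'p) placement \<Rightarrow> ('m, 'k, 'p) placement" where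
  "mass_weighted M X q t = (\<chi> p. M p *\<^sub>R X q t $ p)"

definition velocity ::
  "('m::finite, 'k::finite, 'p::finite) placement
     \<Rightarrow> real^('m + 'k) \<Rightarrow> real^('m + 'k) \<Rightarrow> real \<Rightarrow> (real^3)^'p" where
  "velocity X q w t =
     (\<Sum>i\<in>UNIV. w $ i *\<^sub>R partial (\<lambda>x. X x t) i q) + vector_derivative (X q) (at t)"

definition kinetic ::
  "('p::finite \<Rightarrow> real) \<Rightarrow> ('m::finite, 'k::finite, 'p) placement
     \<Rightarrow> real^('m + 'k) \<Rightarrow> real^('m + 'k) \<Rightarrow> real \<Rightarrow> real" where
  "kinetic M X q w t = 1/2 * (velocity (mass_weighted M X) q w t \<bullet> velocity X q w t)"

definition coeff_g ::
  "('p::finite \<Rightarrow> real) \<Rightarrow> ('m::finite, 'k::finite, 'p) placement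
     \<Rightarrow> 'm + 'k \<Rightarrow> 'm + 'k \<Rightarrow> real^('m + 'k) \<Rightarrow> real \<Rightarrow> real" where
  "coeff_g M X i j q t =
     partial (\<lambda>x. mass_weighted M X x t) i q \<bullet> partial (\<lambda>x. X x t) j q"

definition coeff_b ::
  "('p::finite \<Rightarrow> real) \<Rightarrow> ('m::finite, 'k::finite, 'p) placement
     \<Rightarrow> 'm + 'k \<Rightarrow> real^('m + 'k) \<Rightarrow> real \<Rightarrow> real" where
  "coeff_b M X i q t =
     partial (\<lambda>x. mass_weighted M X x t) i q \<bullet> vector_derivative (X q) (at t)"

definition coeff_c ::
  "('p::finite \<Rightarrow> real) \<Rightarrow> ('m::finite, 'k::finite, 'p) placement
     \<Rightarrow> real^('m + 'k) \<Rightarrow> real \<Rightarrow> real" where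
  "coeff_c M X q t =
     1/2 * (vector_derivative (mass_weighted M X q) (at t) \<bullet> vector_derivative (X q) (at t))"

definition gen_force ::
  "('m::finite, 'k::finite, 'p::finite) placement \<Rightarrow> ((real^3)^'p \<Rightarrow> real \<Rightarrow> (real^3)^'p)
     \<Rightarrow> 'm + 'k \<Rightarrow> real^('m + 'k) \<Rightarrow> real \<Rightarrow> real" where
  "gen_force X F j q t = F (X q t) t \<bullet> partial (\<lambda>x. X x t) j q"

definition full_velocity ::
  "('m::finite, 'k::finite) constraints
     \<Rightarrow> real^('m + 'k) \<Rightarrow> real^'m \<Rightarrow> real \<Rightarrow> real^('m + 'k)" where
  "full_velocity \<alpha> q v t = (\<chi> i. case i of Inl r \<Rightarrow> v $ r | Inr \<nu> \<Rightarrow> \<alpha> \<nu> q v t)"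

definition kinetic_restr ::
  "('p::finite \<Rightarrow> real) \<Rightarrow> ('m::finite, 'k::finite, 'p) placement \<Rightarrow> ('m, 'k) constraints
     \<Rightarrow> real^('m + 'k) \<Rightarrow> real^'m \<Rightarrow> real \<Rightarrow> real" where
  "kinetic_restr M X \<alpha> q v t = kinetic M X q (full_velocity \<alpha> q v t) t"

definition lagrangian_restr ::
  "('p::finite \<Rightarrow> real) \<Rightarrow> ('m::finite, 'k::finite, 'p) placement \<Rightarrow> ('m, 'k) constraints
     \<Rightarrow> (real^('m + 'k) \<Rightarrow> real \<Rightarrow> real) \<Rightarrow> real^('m + 'k) \<Rightarrow> real^'m \<Rightarrow> real \<Rightarrow> real" where
  "lagrangian_restr M X \<alpha> U q v t = kinetic_restr M X \<alpha> q v t + U q t"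

definition energy_restr ::
  "('p::finite \<Rightarrow> real) \<Rightarrow> ('m::finite, 'k::finite, 'p) placement \<Rightarrow> ('m, 'k) constraints
     \<Rightarrow> (real^('m + 'k) \<Rightarrow> real \<Rightarrow> real) \<Rightarrow> real^('m + 'k) \<Rightarrow> real^'m \<Rightarrow> real \<Rightarrow> real" where
  "energy_restr M X \<alpha> U q v t =
     (\<Sum>i\<in>UNIV. v $ i * partial (\<lambda>y. lagrangian_restr M X \<alpha> U q y t) i v)
     - lagrangian_restr M X \<alpha> U q v t"

text \<open>The coefficients $B_i^\nu$; \<open>v\<close> and \<open>a\<close> are the independent velocities and accelerations.\<close>

definition coeff_B ::
  "('m::finite, 'k::finite) constraints \<Rightarrow> 'm \<Rightarrow> 'k
     \<Rightarrow> real^('m + 'k) \<Rightarrow> real^'m \<Rightarrow> real^'m \<Rightarrow> real \<Rightarrow> real" where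
  "coeff_B \<alpha> i \<nu> q v a t =
     (\<Sum>r\<in>UNIV.
        partial (\<lambda>y. partial (\<lambda>x. \<alpha> \<nu> x y t) (Inl r) q) i v * v $ r
      + partial (\<lambda>y. partial (\<lambda>z. \<alpha> \<nu> q z t) r y) i v * a $ r)
     - partial (\<lambda>x. \<alpha> \<nu> x v t) (Inl i) q
     + (\<Sum>\<mu>\<in>UNIV.
        partial (\<lambda>y. partial (\<lambda>x. \<alpha> \<nu> x y t) (Inr \<mu>) q) i v * \<alpha> \<mu> q v t
      - partial (\<lambda>y. \<alpha> \<mu> q y t) i v * partial (\<lambda>x. \<alpha> \<nu> x v t) (Inr \<mu>) q)
     + partial (\<lambda>y. deriv (\<lambda>s. \<alpha> \<nu> q y s) t) i v"

definition indep_vel :: "(real \<Rightarrow> real^('m::finite + 'k::finite)) \<Rightarrow> real \<Rightarrow> real^'m" where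
  "indep_vel q t = (\<chi> r. deriv (\<lambda>s. q s $ Inl r) t)"

definition indep_acc :: "(real \<Rightarrow> real^('m::finite + 'k::finite)) \<Rightarrow> real \<Rightarrow> real^'m" where
  "indep_acc q t = (\<chi> r. deriv (\<lambda>s. indep_vel q s $ r) t)"

definition constraint_eq ::
  "('m::finite, 'k::finite) constraints
     \<Rightarrow> (real \<Rightarrow> real^('m + 'k)) \<Rightarrow> 'k \<Rightarrow> real \<Rightarrow> bool" where
  "constraint_eq \<alpha> q \<nu> t \<longleftrightarrow> deriv (\<lambda>s. q s $ Inr \<nu>) t = \<alpha> \<nu> (q t) (indep_vel q t) t"

definition motion_eq ::
  "('p::finite \<Rightarrow> real) \<Rightarrow> ('m::finite, 'k::finite, 'p) placement \<Rightarrow> ('m, 'k) constraints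
     \<Rightarrow> ((real^3)^'p \<Rightarrow> real \<Rightarrow> (real^3)^'p)
     \<Rightarrow> (real \<Rightarrow> real^('m + 'k)) \<Rightarrow> 'm \<Rightarrow> real \<Rightarrow> bool" where
  "motion_eq M X \<alpha> F q i t \<longleftrightarrow>
     deriv (\<lambda>s. partial (\<lambda>y. kinetic_restr M X \<alpha> (q s) y s) i (indep_vel q s)) t
     - partial (\<lambda>x. kinetic_restr M X \<alpha> x (indep_vel q t) t) (Inl i) (q t)
     - (\<Sum>\<nu>\<in>UNIV. partial (\<lambda>x. kinetic_restr M X \<alpha> x (indep_vel q t) t) (Inr \<nu>) (q t)
                   * partial (\<lambda>y. \<alpha> \<nu> (q t) y t) i (indep_vel q t))
     - (\<Sum>\<nu>\<in>UNIV. coeff_B \<alpha> i \<nu> (q t) (indep_vel q t) (indep_acc q t) t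
                   * partial (\<lambda>w. kinetic M X (q t) w t) (Inr \<nu>)
                       (full_velocity \<alpha> (q t) (indep_vel q t) t))
     = gen_force X F (Inl i) (q t) t
       + (\<Sum>\<nu>\<in>UNIV. partial (\<lambda>y. \<alpha> \<nu> (q t) y t) i (indep_vel q t)
                     * gen_force X F (Inr \<nu>) (q t) t)"

text \<open>
  The differentiability clauses make every derivative along the motion a genuine one, the library
  derivative operators being total.  Second derivatives of the dependent coordinates need not
  be assumed: they do not occur in the equations.
\<close>

definition solution_on ::
  "('p::finite \<Rightarrow> real) \<Rightarrow> ('m::finite, 'k::finite, 'p) placement \<Rightarrow> ('m, 'k) constraints
     \<Rightarrow> ((real^3)^'p \<Rightarrow> real \<Rightarrow> (real^3)^'p) \<Rightarrow> (real^('m + 'k)) set \<Rightarrow> real set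
     \<Rightarrow> (real \<Rightarrow> real^('m + 'k)) \<Rightarrow> bool" where
  "solution_on M X \<alpha> F Q S q \<longleftrightarrow>
     (\<forall>t\<in>S. q t \<in> Q
          \<and> q differentiable (at t)
          \<and> indep_vel q differentiable (at t)
          \<and> (\<forall>\<nu>. constraint_eq \<alpha> q \<nu> t)
          \<and> (\<forall>i. motion_eq M X \<alpha> F q i t))"

end

theory Submission
  imports Defs
begin

text \<open>
  Why the energy is conserved.  Let \<open>v\<close> be the independent velocities and
  $p_i = \partial T^* / \partial \dot q_i$.  Along a motion the derivative of
  $\sum_i v_i p_i - {\cal L}^*(q, v, t)$ has three contributions.  The terms with accelerations
  cancel, because $\partial {\cal L}^* / \partial \dot q_i = p_i$; the explicit time derivative of
  ${\cal L}^*$ vanishes by hypothesis; and $\sum_i v_i \dot p_i - \sum_j \dot q_j\, \partial {\cal L}^* / \partial q_j$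
  remains.  Multiply the $i$-th equation of motion by $v_i$ and add.  The constraints
  turn $\sum_i v_i \alpha_{\nu,i}$ into $\dot q_{m+\nu}$ (\<open>alpha_power\<close>), so the
  derivatives of $T^*$ and the forces combine to $\sum_j \dot q_j\, \partial {\cal L}^* / \partial q_j$.
  The only other term is $\sum_{i,\nu} v_i B_i^\nu\, \partial T / \partial \dot q_{m+\nu}$, which
  is zero: for constraints that are linear and stationary, each $B_i^\nu$ is the contraction with $v$ of
  coefficients antisymmetric in two velocity indices, so $\sum_i v_i B_i^\nu = 0$ for every
  \<open>\<nu>\<close> (\<open>coeff_B_no_power\<close>).  The calculation is \<open>energy_derivative_along_solution\<close>.

  The explicit form comes from inserting the constraints into the velocity of the system,
  which becomes \<open>N + R\<close> with \<open>N\<close> linear in \<open>v\<close> and \<open>R\<close> the time derivative of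
  the placement.  Since the mass operator \<open>\<mu>\<close> is self-adjoint,
  $2 T^* = \mu N \cdot N + 2 \mu N \cdot R + \mu R \cdot R$.  Passing to the energy keeps
  the quadratic part, removes the linear part and changes the sign of the constant part
  (\<open>energy_restr_eq\<close>).  Splitting \<open>N\<close> into the contributions of independent and of
  dependent coordinates then gives the stated coefficients (\<open>energy_restr_coefficients\<close>).
\<close>

section \<open>Partial derivatives\<close>

lemma has_vector_derivative_along_curve:
  assumes g: "(g has_vector_derivative g') (at t)" and f: "(f has_derivative f') (at (g t))"
  shows "((\<lambda>s. f (g s)) has_vector_derivative f' g') (at t)"
proof -
  have "((\<lambda>s. f (g s)) has_derivative (\<lambda>h. f' (h *\<^sub>R g'))) (at t)"
    using has_derivative_compose[OF g[unfolded has_vector_derivative_def] f] .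
  then show ?thesis
    unfolding has_vector_derivative_def linear_cmul[OF has_derivative_linear[OF f]] .
qed

lemma partial_eq:
  assumes "(f has_derivative f') (at x)"
  shows "partial f i x = f' (axis i 1)"
proof -
  have "((\<lambda>s. x + s *\<^sub>R axis i 1) has_vector_derivative axis i 1) (at 0)"
    unfolding has_vector_derivative_def by (auto intro!: derivative_eq_intros)
  from has_vector_derivative_along_curve[OF this, of f f'] assms
  show ?thesis
    unfolding partial_def by (intro vector_derivative_at) simp
qed

lemma partial_linear:
  assumes "linear f"
  shows "partial f i x = f (axis i 1)"
  by (rule partial_eq[OF bounded_linear_imp_has_derivative])
     (use assms in \<open>simp add: linear_conv_bounded_linear[symmetric]\<close>)

lemma partial_const [simp]: "partial (\<lambda>x. c) i x = 0"
  using partial_eq[of "\<lambda>x. c" "\<lambda>h. 0"] by simp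

text \<open>
  Total derivatives along a motion are computed with Frechet derivatives, whereas the equations of
  motion speak of partial derivatives; this lemma converts between the two.
\<close>

lemma derivative_as_partials:
  fixes f :: "real^'a::finite \<Rightarrow> real"
  assumes "(f has_derivative f') (at x)"
  shows "f' h = (\<Sum>i\<in>UNIV. h $ i * partial f i x)"
proof -
  have lin: "linear f'" using assms by (rule has_derivative_linear)
  have "f' h = f' (\<Sum>i\<in>UNIV. h $ i *\<^sub>R axis i 1)"
    using basis_expansion[of h] by (simp add: scalar_mult_eq_scaleR)
  also have "\<dots> = (\<Sum>i\<in>UNIV. h $ i * f' (axis i 1))"
    by (simp add: linear_sum[OF lin] linear_cmul[OF lin])
  finally show ?thesis using partial_eq[OF assms] by simp
qed

lemma partial_add:
  assumes "f differentiable (at x)" "g differentiable (at x)"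
  shows "partial (\<lambda>z. f z + g z) i x = partial f i x + partial g i x"
proof -
  obtain f' g' where D: "(f has_derivative f') (at x)" "(g has_derivative g') (at x)"
    using assms unfolding differentiable_def by blast
  show ?thesis
    unfolding partial_eq[OF has_derivative_add[OF D]] D[THEN partial_eq] ..
qed

lemma sum_Plus_UNIV:
  fixes f :: "'m::finite + 'k::finite \<Rightarrow> 'b::comm_monoid_add"
  shows "(\<Sum>i\<in>UNIV. f i) = (\<Sum>r\<in>UNIV. f (Inl r)) + (\<Sum>\<nu>\<in>UNIV. f (Inr \<nu>))"
  by (subst UNIV_Plus_UNIV[symmetric], subst sum.Plus) auto

lemma Ck_on_SucD:
  assumes "Ck_on (Suc l) f S"
  shows "\<forall>x\<in>S. f differentiable (at x)"
    and "Ck_on l (\<lambda>x. frechet_derivative f (at x) h) S"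
  using assms unfolding Ck_on.simps by (rule conjunct1, rule spec[OF conjunct2])

lemma differentiable_transform_open:
  assumes "f differentiable (at x)" "open S" "x \<in> S" "\<And>z. z \<in> S \<Longrightarrow> f z = g z"
  shows "g differentiable (at x)"
  using assms has_derivative_transform_within_open unfolding differentiable_def by metis

section \<open>The mass operator\<close>

text \<open>
  The mass matrix, acting on configurations.  Mass weighting is linear, hence commutes with
  all derivatives of the placement.
\<close>

definition weigh :: "('p::finite \<Rightarrow> real) \<Rightarrow> (real^3)^'p \<Rightarrow> (real^3)^'p" where
  "weigh M y = (\<chi> p. M p *\<^sub>R y $ p)"

lemma linear_weigh: "linear (weigh M)"
  by (rule linearI) (auto simp: weigh_def vec_eq_iff algebra_simps)

lemma bounded_linear_weigh: "bounded_linear (weigh M)"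
  using linear_weigh by (simp add: linear_conv_bounded_linear)

lemmas weigh_simps =
  linear_add[OF linear_weigh] linear_cmul[OF linear_weigh] linear_sum[OF linear_weigh]

text \<open>
  The mass matrix is diagonal.  This symmetry makes $g$ symmetric and merges the two mixed
  terms in the expansion of the kinetic energy.
\<close>

lemma weigh_selfadjoint: "weigh M y \<bullet> z = weigh M z \<bullet> y"
  unfolding inner_vec_def[where 'a="real^3"] by (simp add: weigh_def inner_commute)

lemma weigh_inner_sums:
  "weigh M (\<Sum>i\<in>I. a i *\<^sub>R y i) \<bullet> (\<Sum>j\<in>K. b j *\<^sub>R z j)
    = (\<Sum>i\<in>I. \<Sum>j\<in>K. (weigh M (y i) \<bullet> z j) * a i * b j)"
  unfolding weigh_simps inner_sum_left
  by (simp add: inner_sum_right sum_distrib_left mult_ac)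

lemma mass_weighted_eq: "mass_weighted M X x t = weigh M (X x t)"
  by (simp add: mass_weighted_def weigh_def)

section \<open>The restricted kinetic energy as a function of the independent velocities\<close>

text \<open>
  The potential enters as a function of coordinates and time; that the generalized forces are its
  partial derivatives is a hypothesis of the lemmas that speak of forces.
\<close>

locale constrained_system =
  fixes M :: "'p::finite \<Rightarrow> real"
    and X :: "('m::finite, 'k::finite, 'p) placement"
    and A :: "'k \<Rightarrow> 'm \<Rightarrow> real^('m + 'k) \<Rightarrow> real"
    and U :: "real^('m + 'k) \<Rightarrow> real \<Rightarrow> real"
    and Q :: "(real^('m + 'k)) set"
    and J :: "real set"
  assumes open_Q: "open Q" and open_J: "open J"
    and smooth_X: "Ck_on 2 (\<lambda>(x, t). X x t) (Q \<times> J)"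
    and differentiable_A: "x \<in> Q \<Longrightarrow> A \<nu> j differentiable (at x)"
    and differentiable_U: "x \<in> Q \<Longrightarrow> t \<in> J \<Longrightarrow> (\<lambda>z. U (fst z) (snd z)) differentiable (at (x, t))"
begin

abbreviation \<alpha> :: "('m, 'k) constraints" where
  "\<alpha> \<equiv> \<lambda>\<nu> x v t. \<Sum>j\<in>UNIV. A \<nu> j x * v $ j"

abbreviation X_q :: "'m + 'k \<Rightarrow> real^('m + 'k) \<Rightarrow> real \<Rightarrow> (real^3)^'p" where
  "X_q i x t \<equiv> partial (\<lambda>z. X z t) i x"

abbreviation X_t :: "real^('m + 'k) \<Rightarrow> real \<Rightarrow> (real^3)^'p" where
  "X_t x t \<equiv> vector_derivative (X x) (at t)"

text \<open>
  The velocity of the system when only the \<open>r\<close>-th independent velocity is one and the placement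
  is frozen in time; the constraints make the dependent coordinates move along.
\<close>

definition admissible :: "'m \<Rightarrow> real^('m + 'k) \<Rightarrow> real \<Rightarrow> (real^3)^'p" where
  "admissible r x t = X_q (Inl r) x t + (\<Sum>\<nu>\<in>UNIV. A \<nu> r x *\<^sub>R X_q (Inr \<nu>) x t)"

definition vel :: "real^('m + 'k) \<Rightarrow> real^'m \<Rightarrow> real \<Rightarrow> (real^3)^'p" where
  "vel x v t = (\<Sum>r\<in>UNIV. v $ r *\<^sub>R admissible r x t) + X_t x t"

subsection \<open>Smoothness of the placement\<close>

lemma X_has_derivative:
  assumes "x \<in> Q" "t \<in> J"
  defines "D \<equiv> frechet_derivative (\<lambda>(x, t). X x t) (at (x, t))"
  shows "((\<lambda>(x, t). X x t) has_derivative D) (at (x, t))"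
    and "((\<lambda>z. X z t) has_derivative (\<lambda>h. D (h, 0))) (at x)"
    and "(X x has_vector_derivative D (0, 1)) (at t)"
proof -
  show D: "((\<lambda>(x, t). X x t) has_derivative D) (at (x, t))"
    unfolding D_def frechet_derivative_works[symmetric]
    using Ck_on_SucD(1)[OF smooth_X[unfolded numeral_2_eq_2]] assms(1,2) by (rule bspec[OF _ SigmaI])
  have "((\<lambda>z. (z, t)) has_derivative (\<lambda>h. (h, 0))) (at x)"
    by (intro has_derivative_Pair has_derivative_ident has_derivative_const)
  from has_derivative_compose[OF this D]
  show "((\<lambda>z. X z t) has_derivative (\<lambda>h. D (h, 0))) (at x)" by simp
  have "((\<lambda>s. (x, s)) has_vector_derivative (0, 1)) (at t)"
    by (intro has_vector_derivative_Pair has_vector_derivative_const has_vector_derivative_id)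
  from has_vector_derivative_along_curve[OF this D]
  show "(X x has_vector_derivative D (0, 1)) (at t)" by simp
qed

lemma X_q_eq:
  assumes "x \<in> Q" "t \<in> J"
  shows "X_q i x t = frechet_derivative (\<lambda>(x, t). X x t) (at (x, t)) (axis i 1, 0)"
  using partial_eq[OF X_has_derivative(2)[OF assms]] .

lemma X_t_eq:
  assumes "x \<in> Q" "t \<in> J"
  shows "X_t x t = frechet_derivative (\<lambda>(x, t). X x t) (at (x, t)) (0, 1)"
  using vector_derivative_at[OF X_has_derivative(3)[OF assms]] .

text \<open>
  The entries of the second derivative are available for the Frechet derivative in a fixed
  direction.  The partial derivatives are such directional derivatives only on the domain,
  which is open, so differentiability carries over.
\<close>

lemma differentiable_X_derivatives:
  assumes "x \<in> Q" "t \<in> J"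
  shows "(\<lambda>z. X_q i (fst z) (snd z)) differentiable (at (x, t))" (is ?q)
    and "(\<lambda>z. X_t (fst z) (snd z)) differentiable (at (x, t))" (is ?t)
proof -
  let ?D = "\<lambda>h z. frechet_derivative (\<lambda>(x, t). X x t) (at z) h"
  have diff: "?D h differentiable (at (x, t))" for h
    using Ck_on_SucD(1)[OF Ck_on_SucD(2)[OF smooth_X[unfolded numeral_2_eq_2]]] assms
    by (rule bspec[OF _ SigmaI])
  have *: "g differentiable (at (x, t))" if "\<And>z. z \<in> Q \<times> J \<Longrightarrow> ?D h z = g z" for h g
    by (rule differentiable_transform_open[OF diff open_Times[OF open_Q open_J]])
       (use that assms in auto)
  show ?q
    by (rule *[of "(axis i 1, 0)"]) (auto simp: X_q_eq)
  show ?t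
    by (rule *[of "(0, 1)"]) (auto simp: X_t_eq)
qed

lemma mass_weighted_derivatives:
  assumes "x \<in> Q" "t \<in> J"
  shows "partial (\<lambda>z. mass_weighted M X z t) i x = weigh M (X_q i x t)"
    and "vector_derivative (mass_weighted M X x) (at t) = weigh M (X_t x t)"
proof -
  note D = X_has_derivative[OF assms]
  show "partial (\<lambda>z. mass_weighted M X z t) i x = weigh M (X_q i x t)"
    unfolding mass_weighted_eq partial_eq[OF D(2)]
    by (rule partial_eq[OF bounded_linear.has_derivative[OF bounded_linear_weigh D(2)]])
  show "vector_derivative (mass_weighted M X x) (at t) = weigh M (X_t x t)"
    unfolding mass_weighted_eq[abs_def] vector_derivative_at[OF D(3)]
    by (rule vector_derivative_at[OF bounded_linear.has_vector_derivative[OF bounded_linear_weigh D(3)]])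
qed

lemma coeff_eqs:
  assumes "x \<in> Q" "t \<in> J"
  shows "coeff_g M X i j x t = weigh M (X_q i x t) \<bullet> X_q j x t"
    and "coeff_b M X i x t = weigh M (X_q i x t) \<bullet> X_t x t"
    and "coeff_c M X x t = 1/2 * (weigh M (X_t x t) \<bullet> X_t x t)"
  unfolding coeff_g_def coeff_b_def coeff_c_def
  by (simp_all add: mass_weighted_derivatives[OF assms])

lemma kinetic_eq:
  assumes "x \<in> Q" "t \<in> J"
  shows "kinetic M X x w t = 1/2 * (weigh M (velocity X x w t) \<bullet> velocity X x w t)"
  unfolding kinetic_def velocity_def
  by (simp add: mass_weighted_derivatives[OF assms] weigh_simps)

lemma kinetic_expansion:
  assumes "x \<in> Q" "t \<in> J"
  shows "kinetic M X x w t
          = 1/2 * (\<Sum>i\<in>UNIV. \<Sum>j\<in>UNIV. coeff_g M X i j x t * w $ i * w $ j)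
            + (\<Sum>i\<in>UNIV. coeff_b M X i x t * w $ i) + coeff_c M X x t"
proof -
  define N where "N = (\<Sum>i\<in>UNIV. w $ i *\<^sub>R X_q i x t)"
  have g: "weigh M N \<bullet> N = (\<Sum>i\<in>UNIV. \<Sum>j\<in>UNIV. coeff_g M X i j x t * w $ i * w $ j)"
    unfolding N_def weigh_inner_sums coeff_eqs[OF assms] ..
  have b: "weigh M N \<bullet> X_t x t = (\<Sum>i\<in>UNIV. coeff_b M X i x t * w $ i)"
    by (simp add: N_def weigh_simps inner_sum_left coeff_eqs[OF assms] mult_ac)
  have "kinetic M X x w t = 1/2 * (weigh M (N + X_t x t) \<bullet> (N + X_t x t))"
    unfolding kinetic_eq[OF assms] by (simp add: velocity_def N_def)
  also have "\<dots> = 1/2 * (weigh M N \<bullet> N) + weigh M N \<bullet> X_t x t + 1/2 * (weigh M (X_t x t) \<bullet> X_t x t)"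
    by (simp add: weigh_simps inner_add_left inner_add_right weigh_selfadjoint[of M "X_t x t" N])
  finally show ?thesis
    by (simp add: g b coeff_eqs[OF assms])
qed

subsection \<open>Momenta and energy\<close>

text \<open>
  Collecting the dependent velocities, which are linear in \<open>v\<close>, exhibits the velocity of
  the system as an affine function of \<open>v\<close>.
\<close>

lemma velocity_restr: "velocity X x (full_velocity \<alpha> x v t) t = vel x v t"
proof -
  have "(\<Sum>\<nu>\<in>UNIV. (\<Sum>j\<in>UNIV. A \<nu> j x * v $ j) *\<^sub>R X_q (Inr \<nu>) x t)
      = (\<Sum>r\<in>UNIV. v $ r *\<^sub>R (\<Sum>\<nu>\<in>UNIV. A \<nu> r x *\<^sub>R X_q (Inr \<nu>) x t))"
    unfolding scaleR_sum_left scaleR_sum_right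
    by (rule trans[OF sum.swap]) (simp add: mult.commute)
  then show ?thesis
    unfolding velocity_def vel_def admissible_def full_velocity_def
    by (simp add: sum_Plus_UNIV scaleR_add_right sum.distrib)
qed

lemma kinetic_restr_eq:
  assumes "x \<in> Q" "t \<in> J"
  shows "kinetic_restr M X \<alpha> x v t = 1/2 * (weigh M (vel x v t) \<bullet> vel x v t)"
  unfolding kinetic_restr_def kinetic_eq[OF assms] velocity_restr ..

lemma vel_has_derivative:
  "((\<lambda>y. vel x y t) has_derivative (\<lambda>h. \<Sum>r\<in>UNIV. h $ r *\<^sub>R admissible r x t)) (at v)"
  unfolding vel_def
  by (auto intro!: derivative_eq_intros bounded_linear_imp_has_derivative[OF bounded_linear_vec_nth])

lemma partial_kinetic_restr:
  assumes "x \<in> Q" "t \<in> J"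
  shows "(\<lambda>y. kinetic_restr M X \<alpha> x y t) differentiable (at v)" (is ?d)
    and "partial (\<lambda>y. kinetic_restr M X \<alpha> x y t) i v = weigh M (admissible i x t) \<bullet> vel x v t" (is ?p)
proof -
  let ?V' = "\<lambda>h. \<Sum>r\<in>UNIV. h $ r *\<^sub>R admissible r x t"
  have D: "((\<lambda>y. kinetic_restr M X \<alpha> x y t) has_derivative
      (\<lambda>h. 1/2 * (weigh M (vel x v t) \<bullet> ?V' h + weigh M (?V' h) \<bullet> vel x v t))) (at v)"
    unfolding kinetic_restr_eq[OF assms]
    by (rule has_derivative_mult_right has_derivative_inner
        bounded_linear.has_derivative[OF bounded_linear_weigh] vel_has_derivative)+
  then show ?d unfolding differentiable_def by blast
  have "?V' (axis i 1) = admissible i x t"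
    by (simp add: axis_def if_distrib[of "\<lambda>c. c *\<^sub>R _"] cong: if_cong)
  then show ?p
    using partial_eq[OF D, of i] weigh_selfadjoint[of M "vel x v t" "admissible i x t"] by simp
qed

lemma partial_lagrangian_restr:
  assumes "x \<in> Q" "t \<in> J"
  shows "partial (\<lambda>y. lagrangian_restr M X \<alpha> U x y t) i v
      = partial (\<lambda>y. kinetic_restr M X \<alpha> x y t) i v"
  unfolding lagrangian_restr_def
  using partial_add[OF partial_kinetic_restr(1)[OF assms], of "\<lambda>y. U x t"] by simp

text \<open>
  Euler's identity for homogeneous functions: the operator $\sum_i v_i \partial_{v_i} - 1$
  multiplies the part of degree \<open>d\<close> by \<open>d - 1\<close>.  With \<open>N\<close> the part of the velocity linear in \<open>v\<close>,
  the quadratic part of the kinetic energy survives, the linear part cancels, and the sign of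
  the part of degree zero changes.
\<close>

lemma energy_restr_eq:
  assumes "x \<in> Q" "t \<in> J"
  defines "N \<equiv> \<lambda>v. \<Sum>r\<in>UNIV. v $ r *\<^sub>R admissible r x t"
  shows "energy_restr M X \<alpha> U x v t = 1/2 * (weigh M (N v) \<bullet> N v) - U x t - coeff_c M X x t"
proof -
  have V: "vel x v t = N v + X_t x t" by (simp add: vel_def N_def)
  have "(\<Sum>i\<in>UNIV. v $ i * partial (\<lambda>y. lagrangian_restr M X \<alpha> U x y t) i v)
      = weigh M (N v) \<bullet> vel x v t"
    by (simp add: partial_lagrangian_restr partial_kinetic_restr assms(1,2) N_def weigh_simps
        inner_sum_left)
  then show ?thesis
    unfolding energy_restr_def lagrangian_restr_def kinetic_restr_eq[OF assms(1,2)]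
      coeff_eqs[OF assms(1,2)] V
    by (simp add: weigh_simps inner_add_left inner_add_right weigh_selfadjoint[of M "X_t x t" "N v"]
        field_simps)
qed

text \<open>
  Splitting the linear part of the velocity into \<open>a\<close>, coming from the independent coordinates, and
  \<open>e\<close>, coming from the dependent ones, produces the three groups of coefficients; the mixed one
  occurs twice in the square, which compensates the factor one half.
\<close>

lemma energy_restr_coefficients:
  assumes "x \<in> Q" "t \<in> J"
  shows "energy_restr M X \<alpha> U x v t
          = (\<Sum>r\<in>UNIV. \<Sum>s\<in>UNIV.
               (1/2 * coeff_g M X (Inl r) (Inl s) x t
                + 1/2 * (\<Sum>\<nu>\<in>UNIV. \<Sum>\<mu>\<in>UNIV.
                           coeff_g M X (Inr \<nu>) (Inr \<mu>) x t * A \<nu> r x * A \<mu> s x)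
                + (\<Sum>\<nu>\<in>UNIV. coeff_g M X (Inl r) (Inr \<nu>) x t * A \<nu> s x))
               * v $ r * v $ s)
            - U x t - coeff_c M X x t"
proof -
  define a where "a = (\<Sum>r\<in>UNIV. v $ r *\<^sub>R X_q (Inl r) x t)"
  define d where "d r = (\<Sum>\<nu>\<in>UNIV. A \<nu> r x *\<^sub>R X_q (Inr \<nu>) x t)" for r
  define e where "e = (\<Sum>r\<in>UNIV. v $ r *\<^sub>R d r)"
  have gd: "weigh M (d r) \<bullet> d s
      = (\<Sum>\<nu>\<in>UNIV. \<Sum>\<mu>\<in>UNIV. coeff_g M X (Inr \<nu>) (Inr \<mu>) x t * A \<nu> r x * A \<mu> s x)" for r s
    unfolding d_def weigh_inner_sums coeff_eqs[OF assms] ..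
  have gx: "weigh M (X_q (Inl r) x t) \<bullet> d s
      = (\<Sum>\<nu>\<in>UNIV. coeff_g M X (Inl r) (Inr \<nu>) x t * A \<nu> s x)" for r s
    by (simp add: d_def inner_sum_right coeff_eqs[OF assms] mult_ac)
  have N: "(\<Sum>r\<in>UNIV. v $ r *\<^sub>R admissible r x t) = a + e"
    by (simp add: admissible_def a_def e_def d_def scaleR_add_right sum.distrib)
  have "1/2 * (weigh M (a + e) \<bullet> (a + e))
      = 1/2 * (weigh M a \<bullet> a) + 1/2 * (weigh M e \<bullet> e) + weigh M a \<bullet> e"
    by (simp add: weigh_simps inner_add_left inner_add_right weigh_selfadjoint[of M e a])
  also have "\<dots> = (\<Sum>r\<in>UNIV. \<Sum>s\<in>UNIV.
      (1/2 * coeff_g M X (Inl r) (Inl s) x t + 1/2 * (weigh M (d r) \<bullet> d s)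
        + weigh M (X_q (Inl r) x t) \<bullet> d s) * v $ r * v $ s)"
    unfolding a_def e_def weigh_inner_sums coeff_eqs[OF assms]
    by (simp add: sum.distrib distrib_right sum_distrib_left mult.assoc)
  finally show ?thesis
    unfolding energy_restr_eq[OF assms] N by (simp add: gd gx)
qed

subsection \<open>Joint differentiability\<close>

lemma differentiable_ignore_velocity:
  assumes "(\<lambda>z. f (fst z) (snd z)) differentiable (at (x, t))"
  shows "(\<lambda>z. f (fst z) (snd (snd z))) differentiable (at (x, v, t))"
proof -
  have pr: "(\<lambda>z. (fst z, snd (snd z))) differentiable (at (x, v, t))"
    unfolding differentiable_def
    by (rule exI, (rule has_derivative_Pair has_derivative_fst has_derivative_snd has_derivative_ident)+)
  show ?thesis
    using differentiable_compose[OF _ pr, of "\<lambda>z. f (fst z) (snd z)"] assms by simp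
qed

lemma differentiable_admissible:
  assumes "x \<in> Q" "t \<in> J"
  shows "(\<lambda>z. admissible r (fst z) (snd (snd z))) differentiable (at (x, v, t))"
proof -
  have "fst differentiable (at (x, v, t))"
    unfolding differentiable_def by (rule exI, (rule has_derivative_fst has_derivative_ident)+)
  then have A: "(\<lambda>z. A \<nu> r (fst z)) differentiable (at (x, v, t))" for \<nu>
    by (intro differentiable_compose[of "A \<nu> r" fst]) (simp add: differentiable_A assms)
  note Xq = differentiable_ignore_velocity[where f="X_q i" for i, OF differentiable_X_derivatives(1)[OF assms]]
  show ?thesis
    unfolding admissible_def
    by (intro differentiable_add differentiable_sum differentiable_scaleR A Xq ballI finite)
qed

lemma differentiable_vel:
  assumes "x \<in> Q" "t \<in> J"
  shows "(\<lambda>z. vel (fst z) (fst (snd z)) (snd (snd z))) differentiable (at (x, v, t))"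
proof -
  have v: "(\<lambda>z. fst (snd z) $ r) differentiable (at (x, v, t))" for r
    unfolding differentiable_def
    by (rule exI, (rule bounded_linear.has_derivative[OF bounded_linear_vec_nth]
        has_derivative_fst has_derivative_snd has_derivative_ident)+)
  note Xt = differentiable_ignore_velocity[where f=X_t, OF differentiable_X_derivatives(2)[OF assms]]
  show ?thesis
    unfolding vel_def
    by (intro differentiable_add differentiable_sum differentiable_scaleR
        differentiable_admissible assms v Xt ballI finite)
qed

lemma differentiable_weigh:
  "f differentiable (at z) \<Longrightarrow> (\<lambda>z. weigh M (f z)) differentiable (at z)"
  unfolding differentiable_def
  using bounded_linear.has_derivative[OF bounded_linear_weigh] by blast

text \<open>
  The formulas for the kinetic energy and the momenta hold only over the open domain of the
  placement; this lemma transfers differentiability along such a formula.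
\<close>

lemma differentiable_on_domain:
  assumes "\<And>x v t. x \<in> Q \<Longrightarrow> t \<in> J \<Longrightarrow> g x v t = f x v t"
    and "(\<lambda>z. f (fst z) (fst (snd z)) (snd (snd z))) differentiable (at (x, v, t))"
    and "x \<in> Q" "t \<in> J"
  shows "(\<lambda>z. g (fst z) (fst (snd z)) (snd (snd z))) differentiable (at (x, v, t))"
proof -
  have dom: "open (Q \<times> (UNIV \<times> J))"
    by (intro open_Times open_Q open_J open_UNIV)
  show ?thesis
    by (rule differentiable_transform_open[OF assms(2) dom]) (use assms in auto)
qed

lemma differentiable_momentum:
  assumes "x \<in> Q" "t \<in> J"
  shows "(\<lambda>z. partial (\<lambda>y. kinetic_restr M X \<alpha> (fst z) y (snd (snd z))) i (fst (snd z)))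
           differentiable (at (x, v, t))"
proof (rule differentiable_on_domain)
  show "partial (\<lambda>y. kinetic_restr M X \<alpha> x y t) i v = weigh M (admissible i x t) \<bullet> vel x v t"
    if "x \<in> Q" "t \<in> J" for x v t
    using partial_kinetic_restr(2)[OF that] .
qed (intro differentiable_inner differentiable_weigh differentiable_admissible differentiable_vel assms)+

lemma differentiable_kinetic_restr:
  assumes "x \<in> Q" "t \<in> J"
  shows "(\<lambda>z. kinetic_restr M X \<alpha> (fst z) (fst (snd z)) (snd (snd z))) differentiable (at (x, v, t))"
proof (rule differentiable_on_domain)
  show "kinetic_restr M X \<alpha> x v t = 1/2 * (weigh M (vel x v t) \<bullet> vel x v t)"
    if "x \<in> Q" "t \<in> J" for x v t
    using kinetic_restr_eq[OF that] .
qed (intro differentiable_mult differentiable_const differentiable_inner differentiable_weigh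
    differentiable_vel assms)+

lemma differentiable_lagrangian_restr:
  assumes "x \<in> Q" "t \<in> J"
  shows "(\<lambda>z. lagrangian_restr M X \<alpha> U (fst z) (fst (snd z)) (snd (snd z)))
           differentiable (at (x, v, t))"
  unfolding lagrangian_restr_def
  using differentiable_ignore_velocity[where f=U, OF differentiable_U[OF assms]]
  by (intro differentiable_add differentiable_kinetic_restr assms)

subsection \<open>The coefficients \<open>B\<close> do no work\<close>

text \<open>
  The power of generalized forces $c_\nu$ on the dependent coordinates can be
  computed from their transfer to the independent coordinates.
\<close>

lemma alpha_power:
  "(\<Sum>i\<in>UNIV. v $ i * (\<Sum>\<nu>\<in>UNIV. A \<nu> i x * c \<nu>)) = (\<Sum>\<nu>\<in>UNIV. \<alpha> \<nu> x v t * c \<nu>)"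
  unfolding sum_distrib_left sum_distrib_right
  by (rule trans[OF sum.swap]) (simp add: mult_ac)

lemma partial_alpha_velocity: "partial (\<lambda>y. \<alpha> \<nu> x y t) i v = A \<nu> i x"
proof -
  have "linear (\<lambda>y. \<alpha> \<nu> x y t)"
    by (rule linearI) (simp_all add: distrib_left sum.distrib sum_distrib_left mult_ac)
  from partial_linear[OF this] show ?thesis
    by (simp add: axis_def if_distrib[of "\<lambda>c. _ * c"] cong: if_cong)
qed

lemma partial_alpha_position:
  assumes "x \<in> Q"
  shows "partial (\<lambda>z. \<alpha> \<nu> z v t) j x = (\<Sum>l\<in>UNIV. partial (A \<nu> l) j x * v $ l)"
proof -
  have D: "(A \<nu> l has_derivative frechet_derivative (A \<nu> l) (at x)) (at x)" for l
    using differentiable_A[OF assms] by (simp add: frechet_derivative_works[symmetric])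
  have "((\<lambda>z. \<alpha> \<nu> z v t) has_derivative
      (\<lambda>h. \<Sum>l\<in>UNIV. frechet_derivative (A \<nu> l) (at x) h * v $ l)) (at x)"
    by (intro has_derivative_sum has_derivative_mult_left D)
  from partial_eq[OF this] show ?thesis
    by (simp add: partial_eq[OF D])
qed

text \<open>
  For linear constraints the acceleration term disappears because the second velocity
  derivative of $\alpha_\nu$ is zero, and the explicit time derivative because the
  coefficients depend on position only.
\<close>

lemma coeff_B_linear:
  assumes "x \<in> Q"
  shows "coeff_B \<alpha> i \<nu> x v a t
    = (\<Sum>r\<in>UNIV. partial (A \<nu> i) (Inl r) x * v $ r) - (\<Sum>l\<in>UNIV. partial (A \<nu> l) (Inl i) x * v $ l)
      + (\<Sum>\<mu>\<in>UNIV. partial (A \<nu> i) (Inr \<mu>) x * \<alpha> \<mu> x v t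
                 - A \<mu> i x * (\<Sum>l\<in>UNIV. partial (A \<nu> l) (Inr \<mu>) x * v $ l))"
proof -
  have "linear (\<lambda>y. \<Sum>l\<in>UNIV. partial (A \<nu> l) j x * y $ l)" for j
    by (rule linearI) (simp_all add: distrib_left sum.distrib sum_distrib_left mult_ac)
  from partial_linear[OF this]
  have "partial (\<lambda>y. \<Sum>l\<in>UNIV. partial (A \<nu> l) j x * y $ l) i v = partial (A \<nu> i) j x" for j
    by (simp add: axis_def if_distrib[of "\<lambda>c. _ * c"] cong: if_cong)
  then show ?thesis
    unfolding coeff_B_def partial_alpha_position[OF assms] partial_alpha_velocity
    by simp
qed

text \<open>
  The first two sums of \<open>coeff_B_linear\<close> differ by exchanging the free index with the summation
  index, so their contractions with \<open>v\<close> agree.  Contracting the third with \<open>v\<close> turns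
  $\alpha_{\mu,i}$ into $\alpha_\mu$ and makes its two parts agree in the same way.
\<close>

lemma coeff_B_no_power:
  assumes "x \<in> Q"
  shows "(\<Sum>i\<in>UNIV. v $ i * coeff_B \<alpha> i \<nu> x v a t) = 0"
proof -
  let ?D = "\<lambda>j. \<Sum>l\<in>UNIV. partial (A \<nu> l) j x * v $ l"
  have 1: "(\<Sum>i\<in>UNIV. v $ i * (\<Sum>r\<in>UNIV. partial (A \<nu> i) (Inl r) x * v $ r))
      = (\<Sum>i\<in>UNIV. v $ i * ?D (Inl i))"
    unfolding sum_distrib_left by (rule trans[OF sum.swap]) (simp add: mult_ac)
  have 2: "(\<Sum>i\<in>UNIV. v $ i * (\<Sum>\<mu>\<in>UNIV. partial (A \<nu> i) (Inr \<mu>) x * \<alpha> \<mu> x v t))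
      = (\<Sum>\<mu>\<in>UNIV. \<alpha> \<mu> x v t * ?D (Inr \<mu>))"
    unfolding sum_distrib_left[of "v $ _"] sum_distrib_left[where r="\<alpha> _ x v t"]
    by (rule trans[OF sum.swap]) (simp add: mult_ac)
  show ?thesis
    unfolding coeff_B_linear[OF assms]
    by (simp add: sum_subtractf sum.distrib right_diff_distrib distrib_left 1 2 alpha_power)
qed

subsection \<open>Conservation along solutions\<close>

text \<open>
  A function of time whose derivative operator returns zero need not be constant unless it is
  differentiable; the joint differentiability of the Lagrangian supplies this.
\<close>

lemma lagrangian_constant_in_time:
  assumes "is_interval J"
    and stationary: "\<And>s. s \<in> J \<Longrightarrow> deriv (\<lambda>s. lagrangian_restr M X \<alpha> U x v s) s = 0"
    and "x \<in> Q" "t \<in> J" "t' \<in> J"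
  shows "lagrangian_restr M X \<alpha> U x v t = lagrangian_restr M X \<alpha> U x v t'"
proof -
  let ?L = "\<lambda>s. lagrangian_restr M X \<alpha> U x v s"
  have "(?L has_field_derivative 0) (at s within J)" if "s \<in> J" for s
  proof -
    have "(\<lambda>s. (x, v, s)) differentiable (at s)"
      unfolding differentiable_def
      by (rule exI, (rule has_derivative_Pair has_derivative_const has_derivative_ident)+)
    from differentiable_compose[OF differentiable_lagrangian_restr[OF \<open>x \<in> Q\<close> \<open>s \<in> J\<close>] this]
    have "?L differentiable (at s)" by simp
    then have "(?L has_field_derivative 0) (at s)"
      using stationary[OF \<open>s \<in> J\<close>] DERIV_deriv_iff_real_differentiable[of ?L s] by simp
    then show ?thesis by (rule has_field_derivative_at_within)
  qed
  then obtain c where "\<And>s. s \<in> J \<Longrightarrow> ?L s = c"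
    using has_field_derivative_zero_constant[of J ?L] assms(1) is_interval_convex by blast
  then show ?thesis using assms by simp
qed

lemma energy_constant_in_time:
  assumes "is_interval J"
    and stationary: "\<And>v s. s \<in> J \<Longrightarrow> deriv (\<lambda>s. lagrangian_restr M X \<alpha> U x v s) s = 0"
    and "x \<in> Q" "t \<in> J" "t' \<in> J"
  shows "energy_restr M X \<alpha> U x v t = energy_restr M X \<alpha> U x v t'"
  unfolding energy_restr_def
  using lagrangian_constant_in_time[OF assms] by simp

text \<open>
  The energy balance.  The derivative \<open>L'\<close> of the Lagrangian along the motion is split
  into its position, velocity and time parts: the position part is the power supplied by the
  equations of motion, the velocity part cancels against the accelerations in $\sum_i v_i p_i$,
  and the time part vanishes.
\<close>

lemma energy_derivative_along_solution:
  assumes sol: "solution_on M X \<alpha> F Q S q" and S: "open S" "S \<subseteq> J" "t \<in> S"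
    and force: "\<And>i x. x \<in> Q \<Longrightarrow> gen_force X F i x t = partial (\<lambda>z. U z t) i x"
    and stationary: "\<And>x v. x \<in> Q \<Longrightarrow> deriv (\<lambda>s. lagrangian_restr M X \<alpha> U x v s) t = 0"
  shows "((\<lambda>s. energy_restr M X \<alpha> U (q s) (indep_vel q s) s) has_real_derivative 0) (at t)"
proof -
  define v where "v = indep_vel q"
  define p where "p i s = partial (\<lambda>y. kinetic_restr M X \<alpha> (q s) y s) i (v s)" for i s
  let ?T = "kinetic_restr M X \<alpha>" and ?L = "lagrangian_restr M X \<alpha> U"
  let ?f = "\<lambda>i. gen_force X F i (q t) t"
  let ?T_q = "\<lambda>i. partial (\<lambda>x. ?T x (v t) t) i (q t)"
  have dom: "q s \<in> Q" "s \<in> J" if "s \<in> S" for s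
    using sol S that by (auto simp: solution_on_def)
  note domt = dom[OF \<open>t \<in> S\<close>]
  obtain q' v' where q': "(q has_vector_derivative q') (at t)"
    and v': "(v has_vector_derivative v') (at t)"
    using sol S unfolding solution_on_def v_def by (meson vector_derivative_works)
  have comp: "deriv (\<lambda>s. q s $ j) t = q' $ j" for j
    using bounded_linear.has_vector_derivative[OF bounded_linear_vec_nth q', of j]
    by (intro DERIV_imp_deriv) (simp add: has_real_derivative_iff_has_vector_derivative)
  \<comment> \<open>The derivative of the curve in configuration space is the full velocity: the dependent
    components are given by the constraints.\<close>
  have q'_Inl: "q' $ Inl r = v t $ r" for r
    using comp[of "Inl r"] by (simp add: v_def indep_vel_def)
  have q'_Inr: "q' $ Inr \<nu> = \<alpha> \<nu> (q t) (v t) t" for \<nu>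
    using comp[of "Inr \<nu>"] sol S by (simp add: v_def solution_on_def constraint_eq_def)
  have curve: "((\<lambda>s. (q s, v s, s)) has_vector_derivative (q', v', 1)) (at t)"
    using q' v' by (intro has_vector_derivative_Pair has_vector_derivative_id)

  obtain L' where L': "((\<lambda>z. ?L (fst z) (fst (snd z)) (snd (snd z))) has_derivative L') (at (q t, v t, t))"
    using differentiable_lagrangian_restr[OF domt] unfolding differentiable_def by blast
  have lin: "linear L'" using L' by (rule has_derivative_linear)
  have "((\<lambda>s. (q t, v t, s)) has_vector_derivative (0, 0, 1)) (at t)"
    by (intro has_vector_derivative_Pair has_vector_derivative_const has_vector_derivative_id)
  from has_vector_derivative_along_curve[OF this L']
  have "((\<lambda>s. ?L (q t) (v t) s) has_real_derivative L' (0, 0, 1)) (at t)"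
    by (simp add: has_real_derivative_iff_has_vector_derivative)
  \<comment> \<open>Stationarity, read as a statement on the time part of \<open>L'\<close>.\<close>
  from DERIV_imp_deriv[OF this] stationary[OF domt(1), of "v t"]
  have L'_t: "L' (0, 0, 1) = 0" by simp
  have "((\<lambda>y. (q t, y, t)) has_derivative (\<lambda>h. (0, h, 0))) (at (v t))"
    by (intro has_derivative_Pair has_derivative_const has_derivative_ident)
  from has_derivative_compose[OF this L']
  have "((\<lambda>y. ?L (q t) y t) has_derivative (\<lambda>h. L' (0, h, 0))) (at (v t))" by simp
  from derivative_as_partials[OF this, of v']
  have L'_v: "L' (0, v', 0) = (\<Sum>i\<in>UNIV. v' $ i * p i t)"
    by (simp add: partial_lagrangian_restr[OF domt] p_def)
  have xs: "((\<lambda>x. (x, v t, t)) has_derivative (\<lambda>h. (h, 0, 0))) (at (q t))"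
    by (intro has_derivative_Pair has_derivative_const has_derivative_ident)
  from has_derivative_compose[OF xs L']
  have L_x: "((\<lambda>x. ?L x (v t) t) has_derivative (\<lambda>h. L' (h, 0, 0))) (at (q t))" by simp
  have "(\<lambda>x. (x, v t, t)) differentiable (at (q t))" "(\<lambda>x. (x, t)) differentiable (at (q t))"
    unfolding differentiable_def
    by (rule exI, (rule has_derivative_Pair has_derivative_const has_derivative_ident)+)+
  from differentiable_compose[OF differentiable_kinetic_restr[OF domt] this(1)]
    differentiable_compose[OF differentiable_U[OF domt] this(2)]
  have "(\<lambda>x. ?T x (v t) t) differentiable (at (q t))" "(\<lambda>x. U x t) differentiable (at (q t))"
    by simp_all
  from partial_add[OF this]
  have "partial (\<lambda>x. ?L x (v t) t) i (q t) = ?T_q i + ?f i" for i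
    by (simp add: lagrangian_restr_def force[OF domt(1)])
  with derivative_as_partials[OF L_x, of q']
  have L'_q: "L' (q', 0, 0) = (\<Sum>r\<in>UNIV. v t $ r * (?T_q (Inl r) + ?f (Inl r)))
      + (\<Sum>\<nu>\<in>UNIV. \<alpha> \<nu> (q t) (v t) t * (?T_q (Inr \<nu>) + ?f (Inr \<nu>)))"
    by (simp add: sum_Plus_UNIV q'_Inl q'_Inr)

  \<comment> \<open>The equations of motion multiplied by the independent velocities and added.\<close>
  have power: "(\<Sum>i\<in>UNIV. v t $ i * deriv (p i) t) = L' (q', 0, 0)"
  proof -
    let ?B = "\<lambda>i \<nu>. coeff_B \<alpha> i \<nu> (q t) (v t) (indep_acc q t) t"
    let ?K = "\<lambda>\<nu>. partial (\<lambda>w. kinetic M X (q t) w t) (Inr \<nu>) (full_velocity \<alpha> (q t) (v t) t)"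
    have "deriv (p i) t = ?T_q (Inl i) + ?f (Inl i)
        + (\<Sum>\<nu>\<in>UNIV. A \<nu> i (q t) * (?T_q (Inr \<nu>) + ?f (Inr \<nu>))) + (\<Sum>\<nu>\<in>UNIV. ?B i \<nu> * ?K \<nu>)" for i
    proof -
      have "motion_eq M X \<alpha> F q i t" using sol S by (simp add: solution_on_def)
      then show ?thesis
        unfolding motion_eq_def partial_alpha_velocity v_def[symmetric] p_def[symmetric]
        by (simp add: distrib_left sum.distrib mult.commute)
    qed
    then have "(\<Sum>i\<in>UNIV. v t $ i * deriv (p i) t)
        = (\<Sum>i\<in>UNIV. v t $ i * (?T_q (Inl i) + ?f (Inl i)))
          + (\<Sum>i\<in>UNIV. v t $ i * (\<Sum>\<nu>\<in>UNIV. A \<nu> i (q t) * (?T_q (Inr \<nu>) + ?f (Inr \<nu>))))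
          + (\<Sum>i\<in>UNIV. v t $ i * (\<Sum>\<nu>\<in>UNIV. ?B i \<nu> * ?K \<nu>))"
      by (simp only: distrib_left[of "v t $ _"] sum.distrib)
    also have "(\<Sum>i\<in>UNIV. v t $ i * (\<Sum>\<nu>\<in>UNIV. ?B i \<nu> * ?K \<nu>))
        = (\<Sum>\<nu>\<in>UNIV. (\<Sum>i\<in>UNIV. v t $ i * ?B i \<nu>) * ?K \<nu>)"
      unfolding sum_distrib_left sum_distrib_right
      by (rule trans[OF sum.swap]) (simp add: mult.assoc)
    finally show ?thesis
      unfolding L'_q alpha_power coeff_B_no_power[OF domt(1)] by simp
  qed

  have "(p i has_real_derivative deriv (p i) t) (at t)" for i
  proof -
    have "(\<lambda>s. (q s, v s, s)) differentiable (at t)"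
      using curve unfolding has_vector_derivative_def differentiable_def by blast
    from differentiable_compose[OF differentiable_momentum[OF domt] this]
    have "p i differentiable (at t)" by (simp add: p_def[abs_def])
    then show ?thesis by (simp add: DERIV_deriv_iff_real_differentiable)
  qed
  moreover have "((\<lambda>s. v s $ i) has_real_derivative v' $ i) (at t)" for i
    using bounded_linear.has_vector_derivative[OF bounded_linear_vec_nth v']
    by (simp add: has_real_derivative_iff_has_vector_derivative)
  moreover have "((\<lambda>s. ?L (q s) (v s) s) has_real_derivative L' (q', v', 1)) (at t)"
    using has_vector_derivative_along_curve[OF curve L']
    by (simp add: has_real_derivative_iff_has_vector_derivative)
  ultimately have "((\<lambda>s. (\<Sum>i\<in>UNIV. v s $ i * p i s) - ?L (q s) (v s) s) has_real_derivative
      (\<Sum>i\<in>UNIV. v' $ i * p i t + deriv (p i) t * v t $ i) - L' (q', v', 1)) (at t)"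
    by (intro DERIV_diff DERIV_sum DERIV_mult)
  also have "(\<Sum>i\<in>UNIV. v' $ i * p i t + deriv (p i) t * v t $ i) - L' (q', v', 1) = 0"
  proof -
    have "L' (q', v', 1) = L' (q', 0, 0) + L' (0, v', 0) + L' (0, 0, 1)"
      by (simp add: linear_add[OF lin, symmetric])
    then show ?thesis
      using power by (simp add: L'_t L'_v sum.distrib mult.commute)
  qed
  \<comment> \<open>The energy is defined with the velocity derivative of the Lagrangian, which is identified
    with \<open>p i\<close> on the domain of the placement; hence the passage through the open set \<open>S\<close>.\<close>
  finally show ?thesis
  proof (rule has_field_derivative_transform_within_open[OF _ \<open>open S\<close> \<open>t \<in> S\<close>])
    fix s assume "s \<in> S"
    then show "(\<Sum>i\<in>UNIV. v s $ i * p i s) - ?L (q s) (v s) s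
        = energy_restr M X \<alpha> U (q s) (indep_vel q s) s"
      by (simp add: energy_restr_def partial_lagrangian_restr dom p_def v_def)
  qed
qed

lemma energy_conserved:
  assumes "solution_on M X \<alpha> F Q S q" "open S" "is_interval S" "S \<subseteq> J"
    and "\<And>i x t. x \<in> Q \<Longrightarrow> t \<in> J \<Longrightarrow> gen_force X F i x t = partial (\<lambda>z. U z t) i x"
    and "\<And>x v t. x \<in> Q \<Longrightarrow> t \<in> J \<Longrightarrow> deriv (\<lambda>s. lagrangian_restr M X \<alpha> U x v s) t = 0"
  shows "(\<lambda>t. energy_restr M X \<alpha> U (q t) (indep_vel q t) t) constant_on S"
  unfolding constant_on_def
proof (rule has_field_derivative_zero_constant)
  show "convex S" using assms(3) by (rule is_interval_convex)
  fix t assume "t \<in> S"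
  with assms show "((\<lambda>t. energy_restr M X \<alpha> U (q t) (indep_vel q t) t) has_field_derivative 0) (at t within S)"
    by (intro has_field_derivative_at_within[OF energy_derivative_along_solution]) auto
qed

end

section \<open>Forces from a potential\<close>

lemma gen_force_potential:
  assumes "(\<lambda>z. X z t) differentiable (at x)"
    and "GDERIV (\<lambda>z. \<U> z t) (X x t) :> F (X x t) t"
  shows "gen_force X F i x t = partial (\<lambda>z. \<U> (X z t) t) i x"
proof -
  obtain D where D: "((\<lambda>z. X z t) has_derivative D) (at x)"
    using assms(1) unfolding differentiable_def by blast
  have "((\<lambda>z. \<U> (X z t) t) has_derivative (\<lambda>h. D h \<bullet> F (X x t) t)) (at x)"
    using has_derivative_compose[OF D assms(2)[unfolded gderiv_def]] .
  then show ?thesis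
    by (simp add: gen_force_def partial_eq[OF D] partial_eq inner_commute)
qed

theorem corollary2:
  fixes M :: "'p::finite \<Rightarrow> real"
    and X :: "real^('m::finite + 'k::finite) \<Rightarrow> real \<Rightarrow> (real^3)^'p"
    and Q :: "(real^('m + 'k)) set"
    and J :: "real set"
    and W :: "(((real^3)^'p) \<times> real) set"
    and \<U> :: "(real^3)^'p \<Rightarrow> real \<Rightarrow> real"
    and F :: "(real^3)^'p \<Rightarrow> real \<Rightarrow> (real^3)^'p"
    and A :: "'k \<Rightarrow> 'm \<Rightarrow> real^('m + 'k) \<Rightarrow> real"
    and \<alpha> :: "'k \<Rightarrow> real^('m + 'k) \<Rightarrow> real^'m \<Rightarrow> real \<Rightarrow> real"
    and U :: "real^('m + 'k) \<Rightarrow> real \<Rightarrow> real"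
  assumes masses: "\<And>p. M p > 0"
    and domains: "open Q" "open J" "is_interval J" "open W"
    and smooth_X: "Ck_on 2 (\<lambda>(x, t). X x t) (Q \<times> J)"
    and smooth_A: "\<And>\<nu> j. Ck_on 1 (A \<nu> j) Q"
    and X_in_W: "\<And>x t. x \<in> Q \<Longrightarrow> t \<in> J \<Longrightarrow> (X x t, t) \<in> W"
    and smooth_pot: "Ck_on 1 (\<lambda>(y, t). \<U> y t) W"
    and force: "\<And>y t. (y, t) \<in> W \<Longrightarrow> GDERIV (\<lambda>z. \<U> z t) y :> F y t"
    and constraints: "\<alpha> = (\<lambda>\<nu> x v t. \<Sum>j\<in>UNIV. A \<nu> j x * v $ j)"
    and U: "U = (\<lambda>x t. \<U> (X x t) t)"
    and stationary: "\<And>x v t. x \<in> Q \<Longrightarrow> t \<in> J \<Longrightarrow>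
                       deriv (\<lambda>s. lagrangian_restr M X \<alpha> U x v s) t = 0"
  shows "(\<forall>i. \<forall>x\<in>Q. \<forall>t\<in>J. gen_force X F i x t = partial (\<lambda>z. U z t) i x)
    \<and> (\<forall>x\<in>Q. \<forall>v. \<forall>t\<in>J. \<forall>t'\<in>J. energy_restr M X \<alpha> U x v t = energy_restr M X \<alpha> U x v t')
    \<and> (\<forall>S q. open S \<and> is_interval S \<and> S \<subseteq> J \<and> solution_on M X \<alpha> F Q S q \<longrightarrow>
          (\<lambda>t. energy_restr M X \<alpha> U (q t) (indep_vel q t) t) constant_on S)
    \<and> (\<forall>x\<in>Q. \<forall>w. \<forall>t\<in>J.
          kinetic M X x w t
          = 1/2 * (\<Sum>i\<in>UNIV. \<Sum>j\<in>UNIV. coeff_g M X i j x t * w $ i * w $ j)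
            + (\<Sum>i\<in>UNIV. coeff_b M X i x t * w $ i) + coeff_c M X x t)
    \<and> ((\<forall>x\<in>Q. \<forall>t\<in>J. \<forall>t'\<in>J.
            (\<forall>i j. coeff_g M X i j x t = coeff_g M X i j x t')
          \<and> (\<forall>i. coeff_b M X i x t = coeff_b M X i x t')
          \<and> coeff_c M X x t = coeff_c M X x t') \<longrightarrow>
        (\<forall>x\<in>Q. \<forall>v. \<forall>t\<in>J.
          energy_restr M X \<alpha> U x v t
          = (\<Sum>r\<in>UNIV. \<Sum>s\<in>UNIV.
               (1/2 * coeff_g M X (Inl r) (Inl s) x t
                + 1/2 * (\<Sum>\<nu>\<in>UNIV. \<Sum>\<mu>\<in>UNIV.
                           coeff_g M X (Inr \<nu>) (Inr \<mu>) x t * A \<nu> r x * A \<mu> s x)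
                + (\<Sum>\<nu>\<in>UNIV. coeff_g M X (Inl r) (Inr \<nu>) x t * A \<nu> s x))
               * v $ r * v $ s)
            - U x t - coeff_c M X x t))"
proof -
  have diff_X: "(\<lambda>(x, t). X x t) differentiable (at (x, t))" if "x \<in> Q" "t \<in> J" for x t
    using Ck_on_SucD(1)[OF smooth_X[unfolded numeral_2_eq_2]] that by (rule bspec[OF _ SigmaI])
  have diff_pot: "(\<lambda>(y, t). \<U> y t) differentiable (at z)" if "z \<in> W" for z
    using Ck_on_SucD(1)[OF smooth_pot[unfolded One_nat_def]] that by (rule bspec)
  have diff_A: "A \<nu> j differentiable (at x)" if "x \<in> Q" for \<nu> j x
    using Ck_on_SucD(1)[OF smooth_A[unfolded One_nat_def]] that by (rule bspec)
  have diff_U: "(\<lambda>z. U (fst z) (snd z)) differentiable (at (x, t))" if "x \<in> Q" "t \<in> J" for x t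
  proof -
    have "(\<lambda>z. (X (fst z) (snd z), snd z)) differentiable (at (x, t))"
      using diff_X[OF that] unfolding differentiable_def case_prod_beta
      by (elim exE) (rule exI, (assumption | rule has_derivative_Pair has_derivative_snd has_derivative_ident)+)
    from differentiable_compose[OF _ this, of "\<lambda>(y, t). \<U> y t"] diff_pot[OF X_in_W[OF that]]
    show ?thesis by (simp add: U)
  qed
  interpret constrained_system M X A U Q J
    using domains smooth_X diff_A diff_U by unfold_locales
  have gen_force: "gen_force X F i x t = partial (\<lambda>z. U z t) i x" if "x \<in> Q" "t \<in> J" for i x t
    unfolding U
  proof (rule gen_force_potential)
    show "(\<lambda>z. X z t) differentiable (at x)"
      using X_has_derivative(2)[OF that] unfolding differentiable_def by blast
    show "GDERIV (\<lambda>z. \<U> z t) (X x t) :> F (X x t) t"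
      by (intro force X_in_W that)
  qed
  note stationary' = stationary[unfolded constraints]
  show ?thesis
    unfolding constraints
    using gen_force energy_constant_in_time[OF domains(3) stationary']
      energy_conserved[OF _ _ _ _ gen_force stationary'] kinetic_expansion energy_restr_coefficients
    by (intro conjI allI ballI impI) blast+
qed

end
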